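(* Let $r,s\ge1$ and let $f_r\in L^2(\Delta_r,\mathbb{R}^{d^r})$ and $g_s\in L^2(\Delta_s,\mathbb{R}^{d^s})$ be symmetric. Then $$\mathbb{E}\left[\mathcal{I}^r(f_r)\mathcal{I}^s(g_s)\right]=1_{\{s=r\}}\,r!\sum_{k_1,\dots,k_r=1}^d\big\langle f_r^{k_1,\dots,k_r},g_s^{k_1,\dots,k_r}\big\rangle ,$$ where for $s=r$, $\langle f_r^{k_1,\dots,k_r},g_r^{k_1,\dots,k_r}\rangle=\sum_{(i_1,\dots,i_r)\in\Delta_r}f_r^{k_1,\dots,k_r}(i_1,\dots,i_r)g_r^{k_1,\dots,k_r}(i_1,\dots,i_r)$.
   Context: $Y=(Y_n)_{n\in\mathbb{N}}$, $Y_n=(Y_n^1,\dots,Y_n^d)$ ($0\in\mathbb{N}$), is an $\mathbb{R}^d$-valued process on a probability space $(\Omega,\mathcal{F},\mathbb{P})$, $\mathcal{F}_n=\sigma(Y_0,\dots,Y_n)$, $\mathcal{F}_{-1}=\{\varnothing,\Omega\}$, with $\mathbb{E}[Y_n^i\,|\,\mathcal{F}_{n-1}]=0$ and $\mathbb{E}[Y_n^iY_n^j\,|\,\mathcal{F}_{n-1}]=\delta^{ij}$ for all $n\ge0$ and $1\le i,j\le d$ (so $(Y_0+\dots+Y_n)_n$ is a normal martingale). $\Delta_r=\{(i_1,\dots,i_r)\in\mathbb{N}^r: i_l\ne i_k,\ 1\le l<k\le r\}$. A function $f_r=(f_r^{k_1,\dots,k_r})_{1\le k_1,\dots,k_r\le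 d}:\Delta_r\to\mathbb{R}^{d^r}$ is symmetric if $f_r^{k_{\sigma(1)},\dots,k_{\sigma(r)}}(i_{\sigma(1)},\dots,i_{\sigma(r)})=f_r^{k_1,\dots,k_r}(i_1,\dots,i_r)$ for every permutation $\sigma$; $L^2(\Delta_r,\mathbb{R}^{d^r})$ is the space of square-summable ones. The multiple stochastic integral is $\mathcal{I}^r(f_r)=\sum_{k_1,\dots,k_r=1}^d\sum_{(i_1,\dots,i_r)\in\Delta_r}f_r^{k_1,\dots,k_r}(i_1,\dots,i_r)Y_{i_1}^{k_1}\cdots Y_{i_r}^{k_r}$ (convergence in $L^2(\Omega)$). *)

theory Defs
  imports "HOL-Probability.Probability" "HOL-Combinatorics.Combinatorics"
begin

text \<open>
  The sigma-algebra generated by the random variables with index strictly below \<open>n\<close>. It is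
  \<open>F\<^sub>n\<^sub>-\<^sub>1\<close>, where \<open>F\<^sub>m = \<sigma>(Y\<^sub>0, \<dots>, Y\<^sub>m)\<close>; for \<open>n = 0\<close> it is the trivial sigma-algebra \<open>F\<^sub>-\<^sub>1\<close>.
\<close>
definition past :: "'a measure \<Rightarrow> (nat \<Rightarrow> 'a \<Rightarrow> 'b::topological_space) \<Rightarrow> nat \<Rightarrow> 'a measure" where
  "past M Y n = sigma (space M) (\<Union>i<n. {Y i -` B \<inter> space M |B. B \<in> sets borel})"

definition Delta :: "nat \<Rightarrow> nat list set" where
  "Delta r = {ns. length ns = r \<and> distinct ns}"

definition multi_indices :: "nat \<Rightarrow> 'd list set" where
  "multi_indices r = {ks. length ks = r}"

text \<open>
  A function on \<open>\<Delta>\<^sub>r\<close> with values in \<open>\<real>\<close> to the power \<open>d\<^sup>r\<close> is encoded as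
  \<open>f :: 'd list \<Rightarrow> nat list \<Rightarrow> real\<close>, the component with upper indices \<open>ks\<close> being \<open>f ks\<close>; only the
  values on \<open>multi_indices r\<close> and \<open>Delta r\<close> matter.
\<close>

definition symmetric_kernel :: "nat \<Rightarrow> ('d list \<Rightarrow> nat list \<Rightarrow> real) \<Rightarrow> bool" where
  "symmetric_kernel r f \<longleftrightarrow>
     (\<forall>\<sigma>. \<sigma> permutes {..<r} \<longrightarrow>
       (\<forall>ks\<in>multi_indices r. \<forall>ns\<in>Delta r.
         f (permute_list \<sigma> ks) (permute_list \<sigma> ns) = f ks ns))"

definition square_summable_kernel :: "nat \<Rightarrow> ('d list \<Rightarrow> nat list \<Rightarrow> real) \<Rightarrow> bool" where
  "square_summable_kernel r f \<longleftrightarrow>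
     (\<forall>ks\<in>multi_indices r. (\<lambda>ns. (f ks ns)\<^sup>2) summable_on Delta r)"

text \<open>
  Unordered summation in \<open>L\<^sup>2\<close>: the finite partial sums converge in mean square along the net of
  finite subsets of the index set. The limit is unique only up to almost sure equality, so
  \<open>L2_sum\<close> selects a representative.
\<close>

definition has_L2_sum :: "'a measure \<Rightarrow> ('i \<Rightarrow> 'a \<Rightarrow> real) \<Rightarrow> 'i set \<Rightarrow> ('a \<Rightarrow> real) \<Rightarrow> bool" where
  "has_L2_sum M h I X \<longleftrightarrow>
     X \<in> borel_measurable M \<and> integrable M (\<lambda>\<omega>. (X \<omega>)\<^sup>2) \<and>
     ((\<lambda>A. \<integral>\<^sup>+\<omega>. ennreal (((\<Sum>i\<in>A. h i \<omega>) - X \<omega>)\<^sup>2) \<partial>M) \<longlongrightarrow> 0) (finite_subsets_at_top I)"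

definition L2_sum :: "'a measure \<Rightarrow> ('i \<Rightarrow> 'a \<Rightarrow> real) \<Rightarrow> 'i set \<Rightarrow> 'a \<Rightarrow> real" where
  "L2_sum M h I = (SOME X. has_L2_sum M h I X)"

definition multiple_integral ::
  "'a measure \<Rightarrow> (nat \<Rightarrow> 'a \<Rightarrow> real^'d) \<Rightarrow> nat \<Rightarrow> ('d list \<Rightarrow> nat list \<Rightarrow> real) \<Rightarrow> 'a \<Rightarrow> real" where
  "multiple_integral M Y r f \<omega> =
     (\<Sum>ks\<in>multi_indices r.
        L2_sum M (\<lambda>ns \<omega>'. f ks ns * (\<Prod>l<r. Y (ns ! l) \<omega>' $ (ks ! l))) (Delta r) \<omega>)"

end

theory Submission
  imports Defs
begin

text \<open>
  A summand \<open>Y\<^bsub>i\<^sub>1\<^esub>\<^bsup>k\<^sub>1\<^esup> \<cdots> Y\<^bsub>i\<^sub>r\<^esub>\<^bsup>k\<^sub>r\<^esup>\<close> with distinct times depends only on the finite partial map \<open>\<phi>\<close> that sends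
  each time \<open>i\<^sub>l\<close> to the coordinate \<open>k\<^sub>l\<close>. The monomials obtained in this way, for all finite partial
  maps \<open>\<phi>\<close> from times to coordinates, are orthonormal in \<open>L\<^sup>2\<close>: conditioning on the past of the latest
  time occurring in a product of two of them removes the factors at that time, because
  \<open>1, Y\<^sub>n\<^sup>1, \<dots>, Y\<^sub>n\<^sup>d\<close> are conditionally orthonormal (\<open>expectation_monomial_mult\<close>).

  A monomial whose domain has \<open>r\<close> elements arises from exactly \<open>r!\<close> pairs of lists, one for each
  simultaneous reordering of times and coordinates, and a symmetric kernel takes the same value on all
  of them (\<open>sum_presentations\<close>). So the inner product of the integral of \<open>g\<close> with the monomial of
  \<open>(ks, ns)\<close> is \<open>r! g ks ns\<close> if the orders agree, and \<open>0\<close> otherwise, since then the domains have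
  different sizes (\<open>expectation_multiple_integral_mult_monomial\<close>). Expanding the integral of \<open>f\<close> into
  monomials and summing these coefficients gives the claim.

  The analytic part is that the series do converge in \<open>L\<^sup>2\<close> (\<open>L2_Cauchy_has_L2_sum\<close>, applied with the
  bound \<open>expectation_sum_monomials_square_le\<close>) and that inner products may be taken term by term
  (\<open>has_L2_sum_inner\<close>).
\<close>

section \<open>Unordered sums in mean square\<close>

lemma integrable_mult_L2:
  fixes u v :: "'a \<Rightarrow> real"
  assumes [measurable]: "u \<in> borel_measurable M" "v \<in> borel_measurable M"
    and "integrable M (\<lambda>\<omega>. (u \<omega>)\<^sup>2)" "integrable M (\<lambda>\<omega>. (v \<omega>)\<^sup>2)"
  shows "integrable M (\<lambda>\<omega>. u \<omega> * v \<omega>)"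
proof (rule Bochner_Integration.integrable_bound)
  show "integrable M (\<lambda>\<omega>. (u \<omega>)\<^sup>2 + (v \<omega>)\<^sup>2)"
    using assms by simp
  have "\<bar>x * y\<bar> \<le> x\<^sup>2 + y\<^sup>2" for x y :: real
  proof -
    have "0 \<le> (\<bar>x\<bar> - \<bar>y\<bar>)\<^sup>2" by simp
    then have "2 * (\<bar>x\<bar> * \<bar>y\<bar>) \<le> x\<^sup>2 + y\<^sup>2" by (simp add: power2_diff)
    moreover have "0 \<le> \<bar>x\<bar> * \<bar>y\<bar>" by simp
    ultimately show ?thesis unfolding abs_mult by linarith
  qed
  then show "AE \<omega> in M. norm (u \<omega> * v \<omega>) \<le> norm ((u \<omega>)\<^sup>2 + (v \<omega>)\<^sup>2)"
    by simp
qed simp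

lemma integrable_sum_square_L2:
  fixes h :: "'i \<Rightarrow> 'a \<Rightarrow> real"
  assumes "\<And>i. i \<in> A \<Longrightarrow> h i \<in> borel_measurable M"
    and "\<And>i. i \<in> A \<Longrightarrow> integrable M (\<lambda>\<omega>. (h i \<omega>)\<^sup>2)"
  shows "integrable M (\<lambda>\<omega>. (\<Sum>i\<in>A. h i \<omega>)\<^sup>2)"
  unfolding power2_eq_square sum_product
  using assms by (intro Bochner_Integration.integrable_sum integrable_mult_L2) auto

lemma integrable_diff_square_L2:
  fixes u v :: "'a \<Rightarrow> real"
  assumes "u \<in> borel_measurable M" "v \<in> borel_measurable M"
    and "integrable M (\<lambda>\<omega>. (u \<omega>)\<^sup>2)" "integrable M (\<lambda>\<omega>. (v \<omega>)\<^sup>2)"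
  shows "integrable M (\<lambda>\<omega>. (u \<omega> - v \<omega>)\<^sup>2)"
proof -
  have "integrable M (\<lambda>\<omega>. (u \<omega>)\<^sup>2 + (v \<omega>)\<^sup>2 - 2 * (u \<omega> * v \<omega>))"
    using assms integrable_mult_L2[OF assms] by simp
  then show ?thesis by (simp add: power2_diff mult.assoc)
qed

lemma Cauchy_Schwarz_integral:
  fixes u v :: "'a \<Rightarrow> real"
  assumes [measurable]: "u \<in> borel_measurable M" "v \<in> borel_measurable M"
    and u: "integrable M (\<lambda>\<omega>. (u \<omega>)\<^sup>2)" and v: "integrable M (\<lambda>\<omega>. (v \<omega>)\<^sup>2)"
  shows "(\<integral>\<omega>. u \<omega> * v \<omega> \<partial>M)\<^sup>2 \<le> (\<integral>\<omega>. (u \<omega>)\<^sup>2 \<partial>M) * (\<integral>\<omega>. (v \<omega>)\<^sup>2 \<partial>M)"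
proof -
  have uv: "integrable M (\<lambda>\<omega>. \<bar>u \<omega>\<bar> * \<bar>v \<omega>\<bar>)"
    using integrable_mult_L2[OF assms] by (simp flip: abs_mult)
  have "(\<integral>\<^sup>+\<omega>. ennreal \<bar>u \<omega>\<bar> * ennreal \<bar>v \<omega>\<bar> \<partial>M)\<^sup>2
      \<le> (\<integral>\<^sup>+\<omega>. (ennreal \<bar>u \<omega>\<bar>)\<^sup>2 \<partial>M) * (\<integral>\<^sup>+\<omega>. (ennreal \<bar>v \<omega>\<bar>)\<^sup>2 \<partial>M)"
    by (rule Cauchy_Schwarz_nn_integral) auto
  also have "(\<integral>\<^sup>+\<omega>. (ennreal \<bar>u \<omega>\<bar>)\<^sup>2 \<partial>M) = ennreal (\<integral>\<omega>. (u \<omega>)\<^sup>2 \<partial>M)"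
    using u by (simp add: ennreal_power nn_integral_eq_integral)
  also have "(\<integral>\<^sup>+\<omega>. (ennreal \<bar>v \<omega>\<bar>)\<^sup>2 \<partial>M) = ennreal (\<integral>\<omega>. (v \<omega>)\<^sup>2 \<partial>M)"
    using v by (simp add: ennreal_power nn_integral_eq_integral)
  also have "(\<integral>\<^sup>+\<omega>. ennreal \<bar>u \<omega>\<bar> * ennreal \<bar>v \<omega>\<bar> \<partial>M) = ennreal (\<integral>\<omega>. \<bar>u \<omega>\<bar> * \<bar>v \<omega>\<bar> \<partial>M)"
    using uv by (simp add: nn_integral_eq_integral flip: ennreal_mult)
  finally have "(\<integral>\<omega>. \<bar>u \<omega>\<bar> * \<bar>v \<omega>\<bar> \<partial>M)\<^sup>2 \<le> (\<integral>\<omega>. (u \<omega>)\<^sup>2 \<partial>M) * (\<integral>\<omega>. (v \<omega>)\<^sup>2 \<partial>M)"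
    by (simp add: ennreal_power flip: ennreal_mult)
  moreover have "\<bar>\<integral>\<omega>. u \<omega> * v \<omega> \<partial>M\<bar> \<le> (\<integral>\<omega>. \<bar>u \<omega>\<bar> * \<bar>v \<omega>\<bar> \<partial>M)"
    using integral_abs_bound[of M "\<lambda>\<omega>. u \<omega> * v \<omega>"] by (simp add: abs_mult)
  then have "(\<integral>\<omega>. u \<omega> * v \<omega> \<partial>M)\<^sup>2 \<le> (\<integral>\<omega>. \<bar>u \<omega>\<bar> * \<bar>v \<omega>\<bar> \<partial>M)\<^sup>2"
    using power_mono[of "\<bar>\<integral>\<omega>. u \<omega> * v \<omega> \<partial>M\<bar>" _ 2] by simp
  ultimately show ?thesis by linarith
qed

lemma has_L2_sum_cong:
  assumes "\<And>i. i \<in> I \<Longrightarrow> h i = h' i"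
  shows "has_L2_sum M h I X \<longleftrightarrow> has_L2_sum M h' I X"
proof -
  have "(\<Sum>i\<in>A. h i \<omega>) = (\<Sum>i\<in>A. h' i \<omega>)" if "A \<subseteq> I" for A \<omega>
    using that assms by (intro sum.cong) auto
  then have "((\<lambda>A. \<integral>\<^sup>+\<omega>. ennreal (((\<Sum>i\<in>A. h i \<omega>) - X \<omega>)\<^sup>2) \<partial>M) \<longlongrightarrow> 0) (finite_subsets_at_top I)
    \<longleftrightarrow> ((\<lambda>A. \<integral>\<^sup>+\<omega>. ennreal (((\<Sum>i\<in>A. h' i \<omega>) - X \<omega>)\<^sup>2) \<partial>M) \<longlongrightarrow> 0) (finite_subsets_at_top I)"
    by (intro tendsto_cong eventually_finite_subsets_at_top_weakI) simp
  then show ?thesis by (simp add: has_L2_sum_def)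
qed

lemma has_L2_sum_iff_integral:
  assumes h: "\<And>i. i \<in> I \<Longrightarrow> h i \<in> borel_measurable M"
    and h2: "\<And>i. i \<in> I \<Longrightarrow> integrable M (\<lambda>\<omega>. (h i \<omega>)\<^sup>2)"
  shows "has_L2_sum M h I X \<longleftrightarrow>
     X \<in> borel_measurable M \<and> integrable M (\<lambda>\<omega>. (X \<omega>)\<^sup>2) \<and>
     ((\<lambda>A. \<integral>\<omega>. ((\<Sum>i\<in>A. h i \<omega>) - X \<omega>)\<^sup>2 \<partial>M) \<longlongrightarrow> 0) (finite_subsets_at_top I)"
proof -
  have "(\<integral>\<^sup>+\<omega>. ennreal (((\<Sum>i\<in>A. h i \<omega>) - X \<omega>)\<^sup>2) \<partial>M)
      = ennreal (\<integral>\<omega>. ((\<Sum>i\<in>A. h i \<omega>) - X \<omega>)\<^sup>2 \<partial>M)"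
    if "A \<subseteq> I" "X \<in> borel_measurable M" "integrable M (\<lambda>\<omega>. (X \<omega>)\<^sup>2)" for A
    using that h h2
    by (intro nn_integral_eq_integral integrable_diff_square_L2 integrable_sum_square_L2
        borel_measurable_sum) auto
  then have "((\<lambda>A. \<integral>\<^sup>+\<omega>. ennreal (((\<Sum>i\<in>A. h i \<omega>) - X \<omega>)\<^sup>2) \<partial>M) \<longlongrightarrow> 0) (finite_subsets_at_top I)
     \<longleftrightarrow> ((\<lambda>A. ennreal (\<integral>\<omega>. ((\<Sum>i\<in>A. h i \<omega>) - X \<omega>)\<^sup>2 \<partial>M)) \<longlongrightarrow> ennreal 0) (finite_subsets_at_top I)"
    if "X \<in> borel_measurable M" "integrable M (\<lambda>\<omega>. (X \<omega>)\<^sup>2)"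
    unfolding ennreal_0 using that by (intro tendsto_cong) (auto intro!: eventually_finite_subsets_at_top_weakI)
  also have "((\<lambda>A. ennreal (\<integral>\<omega>. ((\<Sum>i\<in>A. h i \<omega>) - X \<omega>)\<^sup>2 \<partial>M)) \<longlongrightarrow> ennreal 0) (finite_subsets_at_top I)
     \<longleftrightarrow> ((\<lambda>A. \<integral>\<omega>. ((\<Sum>i\<in>A. h i \<omega>) - X \<omega>)\<^sup>2 \<partial>M) \<longlongrightarrow> 0) (finite_subsets_at_top I)"
    by (rule tendsto_ennreal_iff) auto
  finally show ?thesis unfolding has_L2_sum_def by blast
qed

text \<open>
  The inner product with a fixed square-integrable \<open>e\<close> is continuous along mean-square
  convergence, by Cauchy-Schwarz. Hence \<open>\<langle>X, e\<rangle>\<close> can be computed term by term, and the numerical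
  series converges unconditionally because the \<open>L\<^sup>2\<close> sum does.
\<close>
lemma has_L2_sum_inner:
  assumes h: "\<And>i. i \<in> I \<Longrightarrow> h i \<in> borel_measurable M"
    and h2: "\<And>i. i \<in> I \<Longrightarrow> integrable M (\<lambda>\<omega>. (h i \<omega>)\<^sup>2)"
    and X: "has_L2_sum M h I X"
    and e: "e \<in> borel_measurable M" and e2: "integrable M (\<lambda>\<omega>. (e \<omega>)\<^sup>2)"
  shows "((\<lambda>i. \<integral>\<omega>. h i \<omega> * e \<omega> \<partial>M) has_sum (\<integral>\<omega>. X \<omega> * e \<omega> \<partial>M)) I"
proof -
  let ?S = "\<lambda>A \<omega>. \<Sum>i\<in>A. h i \<omega>" and ?F = "finite_subsets_at_top I"
  let ?D = "\<lambda>A. \<integral>\<omega>. (?S A \<omega> - X \<omega>)\<^sup>2 \<partial>M"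
  have Xm: "X \<in> borel_measurable M" and X2: "integrable M (\<lambda>\<omega>. (X \<omega>)\<^sup>2)"
    and lim: "(?D \<longlongrightarrow> 0) ?F"
    using X by (simp_all add: has_L2_sum_iff_integral[OF h h2])
  have bound: "((\<Sum>i\<in>A. \<integral>\<omega>. h i \<omega> * e \<omega> \<partial>M) - (\<integral>\<omega>. X \<omega> * e \<omega> \<partial>M))\<^sup>2
      \<le> ?D A * (\<integral>\<omega>. (e \<omega>)\<^sup>2 \<partial>M)" if "A \<subseteq> I" for A
  proof -
    have he: "integrable M (\<lambda>\<omega>. h i \<omega> * e \<omega>)" if "i \<in> A" for i
      using that \<open>A \<subseteq> I\<close> by (intro integrable_mult_L2 h h2 e e2) auto
    have Xe: "integrable M (\<lambda>\<omega>. X \<omega> * e \<omega>)"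
      by (intro integrable_mult_L2 Xm X2 e e2)
    have "(\<Sum>i\<in>A. \<integral>\<omega>. h i \<omega> * e \<omega> \<partial>M) - (\<integral>\<omega>. X \<omega> * e \<omega> \<partial>M)
        = (\<integral>\<omega>. (\<Sum>i\<in>A. h i \<omega> * e \<omega>) - X \<omega> * e \<omega> \<partial>M)"
      using he Xe by (simp add: Bochner_Integration.integral_diff Bochner_Integration.integral_sum)
    also have "\<dots> = (\<integral>\<omega>. (?S A \<omega> - X \<omega>) * e \<omega> \<partial>M)"
      by (simp add: left_diff_distrib sum_distrib_right)
    finally show ?thesis
      using that h h2 Xm X2 e e2
      by (auto intro!: Cauchy_Schwarz_integral integrable_diff_square_L2 integrable_sum_square_L2
          borel_measurable_sum borel_measurable_diff)
  qed
  have "((\<lambda>A. ((\<Sum>i\<in>A. \<integral>\<omega>. h i \<omega> * e \<omega> \<partial>M) - (\<integral>\<omega>. X \<omega> * e \<omega> \<partial>M))\<^sup>2) \<longlongrightarrow> 0) ?F"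
  proof (rule tendsto_sandwich[OF _ _ tendsto_const])
    show "((\<lambda>A. ?D A * (\<integral>\<omega>. (e \<omega>)\<^sup>2 \<partial>M)) \<longlongrightarrow> 0) ?F"
      using tendsto_mult_right[OF lim] by simp
  qed (auto intro!: eventually_finite_subsets_at_top_weakI bound)
  then have "((\<lambda>A. (\<Sum>i\<in>A. \<integral>\<omega>. h i \<omega> * e \<omega> \<partial>M) - (\<integral>\<omega>. X \<omega> * e \<omega> \<partial>M)) \<longlongrightarrow> 0) ?F"
    by (drule_tac tendsto_real_sqrt) (simp add: tendsto_rabs_zero_iff)
  then show ?thesis
    unfolding has_sum_def by (simp add: LIM_zero_iff)
qed

text \<open>
  Riesz-Fischer for unordered sums. Increasing finite sets \<open>A n\<close> are chosen so fast that every finite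
  sum outside \<open>A n\<close> has squared norm below \<open>4\<^sup>-\<^sup>n\<close>. On a probability space the \<open>L\<^sup>1\<close> norms of the
  increments \<open>Z n\<close> of the partial sums over \<open>A n\<close> are then summable, so these partial sums converge
  almost everywhere to some \<open>X\<close>. Fatou's lemma carries the estimate from \<open>A m\<close> with \<open>m \<ge> n\<close> to
  \<open>X\<close>, uniformly over all finite sets containing \<open>A n\<close>, which is convergence along the whole net.
\<close>
lemma (in prob_space) L2_Cauchy_has_L2_sum:
  fixes h :: "'i \<Rightarrow> 'a \<Rightarrow> real"
  assumes h: "\<And>i. i \<in> I \<Longrightarrow> h i \<in> borel_measurable M"
    and h2: "\<And>i. i \<in> I \<Longrightarrow> integrable M (\<lambda>\<omega>. (h i \<omega>)\<^sup>2)"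
    and Cauchy: "\<And>\<epsilon>. \<epsilon> > 0 \<Longrightarrow> \<exists>A. finite A \<and> A \<subseteq> I \<and>
      (\<forall>B. finite B \<longrightarrow> B \<subseteq> I - A \<longrightarrow> (\<integral>\<omega>. (\<Sum>i\<in>B. h i \<omega>)\<^sup>2 \<partial>M) < \<epsilon>)"
  shows "\<exists>X. has_L2_sum M h I X"
proof -
  let ?S = "\<lambda>A \<omega>. \<Sum>i\<in>A. h i \<omega>"
  have "\<forall>n. \<exists>A. finite A \<and> A \<subseteq> I \<and>
      (\<forall>B. finite B \<longrightarrow> B \<subseteq> I - A \<longrightarrow> (\<integral>\<omega>. (?S B \<omega>)\<^sup>2 \<partial>M) < (1/4) ^ n)"
    using Cauchy by simp
  then obtain A0 where A0: "\<And>n. finite (A0 n)" "\<And>n. A0 n \<subseteq> I"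
    "\<And>n B. finite B \<Longrightarrow> B \<subseteq> I - A0 n \<Longrightarrow> (\<integral>\<omega>. (?S B \<omega>)\<^sup>2 \<partial>M) < (1/4) ^ n"
    by metis
  define A where "A n = (\<Union>k\<le>n. A0 k)" for n
  have A: "finite (A n)" "A n \<subseteq> I" for n
    using A0 by (auto simp: A_def)
  have A_mono: "A m \<subseteq> A n" if "m \<le> n" for m n
    using that by (fastforce simp: A_def)
  have tail: "(\<integral>\<omega>. (?S B \<omega>)\<^sup>2 \<partial>M) < (1/4) ^ n" if "finite B" "B \<subseteq> I - A n" for B n
    using that by (intro A0) (auto simp: A_def)
  have Sm: "?S B \<in> borel_measurable M" and S2: "integrable M (\<lambda>\<omega>. (?S B \<omega>)\<^sup>2)"
    if "B \<subseteq> I" for B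
    using that h h2 by (auto intro!: integrable_sum_square_L2 borel_measurable_sum)
  \<comment> \<open>Both sums contain the sum over \<open>A n\<close>, which cancels and leaves two tails.\<close>
  have near: "(\<integral>\<omega>. (?S B \<omega> - ?S C \<omega>)\<^sup>2 \<partial>M) \<le> 4 * (1/4) ^ n"
    if B: "finite B" "B \<subseteq> I" "A n \<subseteq> B" and C: "finite C" "C \<subseteq> I" "A n \<subseteq> C" for B C n
  proof -
    have BI: "B - A n \<subseteq> I" "C - A n \<subseteq> I" using B C by auto
    have "?S B \<omega> - ?S C \<omega> = ?S (B - A n) \<omega> - ?S (C - A n) \<omega>" for \<omega>
      using B C A by (simp add: sum_diff)
    then have "(\<integral>\<omega>. (?S B \<omega> - ?S C \<omega>)\<^sup>2 \<partial>M)
        = (\<integral>\<omega>. (?S (B - A n) \<omega> - ?S (C - A n) \<omega>)\<^sup>2 \<partial>M)" by simp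
    also have "\<dots> \<le> (\<integral>\<omega>. 2 * (?S (B - A n) \<omega>)\<^sup>2 + 2 * (?S (C - A n) \<omega>)\<^sup>2 \<partial>M)"
    proof (rule integral_mono)
      show "(x - y)\<^sup>2 \<le> 2 * x\<^sup>2 + 2 * y\<^sup>2" for x y :: real
        using zero_le_power2[of "x + y"] by (simp add: power2_diff power2_sum)
    qed (use BI Sm S2 in \<open>auto intro!: integrable_diff_square_L2\<close>)
    also have "\<dots> = 2 * (\<integral>\<omega>. (?S (B - A n) \<omega>)\<^sup>2 \<partial>M) + 2 * (\<integral>\<omega>. (?S (C - A n) \<omega>)\<^sup>2 \<partial>M)"
      using BI S2 by simp
    also have "\<dots> \<le> 4 * (1/4) ^ n"
      using tail[of "B - A n" n] tail[of "C - A n" n] B C by fastforce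
    finally show ?thesis .
  qed
  define Z where "Z n = ?S (A (Suc n) - A n)" for n
  have Zm[measurable]: "Z n \<in> borel_measurable M" and Z2: "integrable M (\<lambda>\<omega>. (Z n \<omega>)\<^sup>2)" for n
    using A unfolding Z_def by (auto intro!: Sm S2)
  have Z_tail: "(\<integral>\<omega>. (Z n \<omega>)\<^sup>2 \<partial>M) \<le> (1/4) ^ n" for n
    unfolding Z_def by (rule less_imp_le, rule tail) (use A in auto)
  have SA: "?S (A n) \<omega> = ?S (A 0) \<omega> + (\<Sum>k<n. Z k \<omega>)" for n \<omega>
  proof (induction n)
    case (Suc n)
    have "?S (A (Suc n)) \<omega> = ?S (A n) \<omega> + Z n \<omega>"
      using A A_mono[of n "Suc n"] by (simp add: Z_def sum_diff)
    then show ?case using Suc by simp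
  qed simp
  have half_power: "2 ^ n * (1/2) ^ n = (1::real)" for n
    by (simp add: power_one_over)
  have Z1: "(\<integral>\<^sup>+\<omega>. ennreal \<bar>Z n \<omega>\<bar> \<partial>M) \<le> ennreal ((1/2) ^ n)" for n
  proof -
    \<comment> \<open>The inequality of arithmetic and geometric means, weighted so that \<open>\<bar>z\<bar> = 2\<^sup>-\<^sup>n\<close> gives equality.\<close>
    have "\<bar>z\<bar> \<le> (1/2) ^ n / 2 + 2 ^ n / 2 * z\<^sup>2" for z :: real
    proof -
      have "0 \<le> 2 ^ n / 2 * ((1/2) ^ n - \<bar>z\<bar>)\<^sup>2" by simp
      also have "\<dots> = (2 ^ n * (1/2) ^ n) * (1/2) ^ n / 2 + 2 ^ n / 2 * z\<^sup>2 - (2 ^ n * (1/2) ^ n) * \<bar>z\<bar>"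
        unfolding power2_diff power2_abs by (simp only: power2_eq_square) (simp add: field_simps)
      finally have "0 \<le> (1/2) ^ n / 2 + 2 ^ n / 2 * z\<^sup>2 - \<bar>z\<bar>"
        unfolding half_power by simp
      then show ?thesis by simp
    qed
    then have "(\<integral>\<^sup>+\<omega>. ennreal \<bar>Z n \<omega>\<bar> \<partial>M) \<le> (\<integral>\<^sup>+\<omega>. ennreal ((1/2) ^ n / 2 + 2 ^ n / 2 * (Z n \<omega>)\<^sup>2) \<partial>M)"
      by (intro nn_integral_mono ennreal_leI)
    also have "\<dots> = ennreal (\<integral>\<omega>. (1/2) ^ n / 2 + 2 ^ n / 2 * (Z n \<omega>)\<^sup>2 \<partial>M)"
      using Z2 by (intro nn_integral_eq_integral) auto
    also have "(\<integral>\<omega>. (1/2) ^ n / 2 + 2 ^ n / 2 * (Z n \<omega>)\<^sup>2 \<partial>M)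
        = (1/2) ^ n / 2 + 2 ^ n / 2 * (\<integral>\<omega>. (Z n \<omega>)\<^sup>2 \<partial>M)"
      using Z2 by (simp add: prob_space)
    also have "\<dots> \<le> (1/2) ^ n / 2 + 2 ^ n / 2 * (1/4) ^ n"
      by (intro add_left_mono mult_left_mono Z_tail) simp
    also have "2 ^ n / 2 * (1/4) ^ n = (1/2) ^ n / (2::real)"
      using half_power[of n] power_mult_distrib[of "1/2::real" "1/2" n] by simp
    finally show ?thesis by (simp add: ennreal_leI)
  qed
  have "(\<integral>\<^sup>+\<omega>. (\<Sum>n. ennreal \<bar>Z n \<omega>\<bar>) \<partial>M) = (\<Sum>n. \<integral>\<^sup>+\<omega>. ennreal \<bar>Z n \<omega>\<bar> \<partial>M)"
    by (rule nn_integral_suminf) auto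
  also have "\<dots> \<le> (\<Sum>n. ennreal ((1/2) ^ n))"
    by (intro suminf_le Z1) auto
  also have "\<dots> = ennreal (\<Sum>n. (1/2) ^ n)"
    by (intro suminf_ennreal2) auto
  also have "\<dots> < \<infinity>" by simp
  finally have "AE \<omega> in M. (\<Sum>n. ennreal \<bar>Z n \<omega>\<bar>) \<noteq> \<infinity>"
    by (intro nn_integral_PInf_AE) auto
  then have AE_summable: "AE \<omega> in M. summable (\<lambda>n. Z n \<omega>)"
    by eventually_elim (auto intro!: summable_rabs_cancel[OF summable_suminf_not_top])
  define X where "X \<omega> = ?S (A 0) \<omega> + (\<Sum>n. Z n \<omega>)" for \<omega>
  have Xm[measurable]: "X \<in> borel_measurable M"
    unfolding X_def using Sm[OF A(2), of 0] by measurable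
  have AE_lim: "AE \<omega> in M. (\<lambda>n. ?S (A n) \<omega>) \<longlonglongrightarrow> X \<omega>"
    using AE_summable
  proof eventually_elim
    case (elim \<omega>)
    then have "(\<lambda>n. ?S (A 0) \<omega> + (\<Sum>k<n. Z k \<omega>)) \<longlonglongrightarrow> X \<omega>"
      unfolding X_def by (intro tendsto_add tendsto_const summable_LIMSEQ)
    then show ?case by (simp only: flip: SA)
  qed
  have Fatou: "(\<integral>\<^sup>+\<omega>. ennreal ((?S B \<omega> - X \<omega>)\<^sup>2) \<partial>M) \<le> ennreal (4 * (1/4) ^ n)"
    if B: "finite B" "B \<subseteq> I" "A n \<subseteq> B" for B n
  proof -
    have [measurable]: "?S B \<in> borel_measurable M" "\<And>m. ?S (A m) \<in> borel_measurable M"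
      using Sm B A by auto
    have "AE \<omega> in M. ennreal ((?S B \<omega> - X \<omega>)\<^sup>2)
        = liminf (\<lambda>m. ennreal ((?S B \<omega> - ?S (A m) \<omega>)\<^sup>2))"
      using AE_lim
    proof eventually_elim
      case (elim \<omega>)
      then have "(\<lambda>m. ennreal ((?S B \<omega> - ?S (A m) \<omega>)\<^sup>2)) \<longlonglongrightarrow> ennreal ((?S B \<omega> - X \<omega>)\<^sup>2)"
        by (intro tendsto_intros)
      then show ?case by (rule lim_imp_Liminf[OF sequentially_bot, symmetric])
    qed
    then have "(\<integral>\<^sup>+\<omega>. ennreal ((?S B \<omega> - X \<omega>)\<^sup>2) \<partial>M)
        = (\<integral>\<^sup>+\<omega>. liminf (\<lambda>m. ennreal ((?S B \<omega> - ?S (A m) \<omega>)\<^sup>2)) \<partial>M)"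
      by (rule nn_integral_cong_AE)
    also have "\<dots> \<le> liminf (\<lambda>m. \<integral>\<^sup>+\<omega>. ennreal ((?S B \<omega> - ?S (A m) \<omega>)\<^sup>2) \<partial>M)"
      by (rule nn_integral_liminf) auto
    also have "\<dots> \<le> limsup (\<lambda>m. \<integral>\<^sup>+\<omega>. ennreal ((?S B \<omega> - ?S (A m) \<omega>)\<^sup>2) \<partial>M)"
      by (rule Liminf_le_Limsup) simp
    also have "\<dots> \<le> ennreal (4 * (1/4) ^ n)"
    proof (rule Limsup_bounded, rule eventually_sequentiallyI)
      fix m assume "n \<le> m"
      then have "(\<integral>\<omega>. (?S B \<omega> - ?S (A m) \<omega>)\<^sup>2 \<partial>M) \<le> 4 * (1/4) ^ n"
        using B A A_mono by (intro near) auto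
      moreover have "integrable M (\<lambda>\<omega>. (?S B \<omega> - ?S (A m) \<omega>)\<^sup>2)"
        using B A by (intro integrable_diff_square_L2 Sm S2) auto
      ultimately show "(\<integral>\<^sup>+\<omega>. ennreal ((?S B \<omega> - ?S (A m) \<omega>)\<^sup>2) \<partial>M) \<le> ennreal (4 * (1/4) ^ n)"
        by (simp add: nn_integral_eq_integral ennreal_leI)
    qed
    finally show ?thesis .
  qed
  have SX2: "integrable M (\<lambda>\<omega>. (?S B \<omega> - X \<omega>)\<^sup>2)" if "finite B" "B \<subseteq> I" "A n \<subseteq> B" for B n
    using Fatou[OF that] Sm[OF that(2)] by (intro integrableI_bounded) (auto simp: top_unique less_top[symmetric])
  have "integrable M (\<lambda>\<omega>. (?S (A 0) \<omega> - (?S (A 0) \<omega> - X \<omega>))\<^sup>2)"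
  proof (rule integrable_diff_square_L2)
    show "(\<lambda>\<omega>. ?S (A 0) \<omega> - X \<omega>) \<in> borel_measurable M"
      by (rule borel_measurable_diff[OF Sm[OF A(2)] Xm])
    show "integrable M (\<lambda>\<omega>. (?S (A 0) \<omega> - X \<omega>)\<^sup>2)"
      by (rule SX2[OF A subset_refl])
  qed (rule Sm[OF A(2)] S2[OF A(2)])+
  then have X2: "integrable M (\<lambda>\<omega>. (X \<omega>)\<^sup>2)" by simp
  have "((\<lambda>B. \<integral>\<omega>. (?S B \<omega> - X \<omega>)\<^sup>2 \<partial>M) \<longlongrightarrow> 0) (finite_subsets_at_top I)"
  proof (rule tendstoI)
    fix \<epsilon> :: real assume "\<epsilon> > 0"
    then obtain n where n: "(1/4) ^ n < \<epsilon> / 4"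
      using real_arch_pow_inv[of "\<epsilon>/4" "1/4"] by auto
    have "(\<integral>\<omega>. (?S B \<omega> - X \<omega>)\<^sup>2 \<partial>M) < \<epsilon>" if B: "finite B" "B \<subseteq> I" "A n \<subseteq> B" for B
    proof -
      have "(\<integral>\<omega>. (?S B \<omega> - X \<omega>)\<^sup>2 \<partial>M) \<le> 4 * (1/4) ^ n"
        using Fatou[OF B] SX2[OF B] by (simp add: nn_integral_eq_integral)
      then show ?thesis using n by simp
    qed
    then show "eventually (\<lambda>B. dist (\<integral>\<omega>. (?S B \<omega> - X \<omega>)\<^sup>2 \<partial>M) 0 < \<epsilon>) (finite_subsets_at_top I)"
      using A[of n] unfolding eventually_finite_subsets_at_top by (intro exI[of _ "A n"]) auto
  qed
  with Xm X2 have "has_L2_sum M h I X"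
    by (subst has_L2_sum_iff_integral[OF h h2]) simp_all
  then show ?thesis by (rule exI[of _ X])
qed

lemma summable_on_tail_small:
  fixes c :: "'i \<Rightarrow> real"
  assumes c: "c summable_on I" and nonneg: "\<And>i. i \<in> I \<Longrightarrow> 0 \<le> c i" and "\<epsilon> > 0"
  obtains A where "finite A" "A \<subseteq> I" "\<And>B. finite B \<Longrightarrow> B \<subseteq> I - A \<Longrightarrow> sum c B < \<epsilon>"
proof -
  have "(sum c \<longlongrightarrow> infsum c I) (finite_subsets_at_top I)"
    using c by (rule infsum_tendsto)
  then have "eventually (\<lambda>A. dist (sum c A) (infsum c I) < \<epsilon>) (finite_subsets_at_top I)"
    using \<open>\<epsilon> > 0\<close> by (rule tendstoD)
  then obtain A where A: "finite A" "A \<subseteq> I" "dist (sum c A) (infsum c I) < \<epsilon>"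
    unfolding eventually_finite_subsets_at_top by blast
  have "sum c B < \<epsilon>" if "finite B" "B \<subseteq> I - A" for B
  proof -
    have "sum c (A \<union> B) \<le> infsum c I"
      using A that by (intro finite_sum_le_infsum c nonneg) auto
    moreover have "sum c (A \<union> B) = sum c A + sum c B"
      using A that by (intro sum.union_disjoint) auto
    ultimately show ?thesis using A(3) by (simp add: dist_real_def)
  qed
  with A that show ?thesis by blast
qed

section \<open>Orthonormal monomials\<close>

lemma borel_measurable_nth:
  fixes f :: "'a \<Rightarrow> real ^ 'd"
  assumes "f \<in> borel_measurable N"
  shows "(\<lambda>\<omega>. f \<omega> $ i) \<in> borel_measurable N"
  using borel_measurable_inner[OF assms borel_measurable_const[of "axis i 1"]]
  by (simp add: inner_axis)

text \<open>
  The increments of a normal martingale, with respect to the filtration that they generate.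
\<close>
locale normal_noise = prob_space M
  for M :: "'a measure" +
  fixes Y :: "nat \<Rightarrow> 'a \<Rightarrow> real ^ 'd"
  assumes Y_measurable[measurable]: "\<And>n. Y n \<in> borel_measurable M"
    and Y_cond_mean: "\<And>n i. AE \<omega> in M. real_cond_exp M (past M Y n) (\<lambda>\<omega>. Y n \<omega> $ i) \<omega> = 0"
    and Y_cond_cov: "\<And>n i j. AE \<omega> in M.
      real_cond_exp M (past M Y n) (\<lambda>\<omega>. Y n \<omega> $ i * Y n \<omega> $ j) \<omega> = (if i = j then 1 else 0)"
begin

lemma space_past [simp]: "space (past M Y n) = space M"
  by (simp add: past_def space_measure_of_conv)

lemma sets_past: "sets (past M Y n) = sigma_sets (space M) (\<Union>i<n. {Y i -` B \<inter> space M |B. B \<in> sets borel})"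
  unfolding past_def by (rule sets_measure_of) auto

lemma measurable_past: "i < n \<Longrightarrow> Y i \<in> borel_measurable (past M Y n)"
  by (rule measurableI) (auto simp: sets_past intro!: sigma_sets.Basic)

lemma subalgebra_past: "subalgebra M (past M Y n)"
  unfolding subalgebra_def
proof (intro conjI)
  show "sets (past M Y n) \<subseteq> sets M"
    unfolding sets_past by (intro sets.sigma_sets_subset) auto
qed simp

lemma sigma_finite_subalgebra_past: "sigma_finite_subalgebra M (past M Y n)"
  by (intro finite_measure_subalgebra_is_sigma_finite finite_measure_subalgebra.intro
      finite_measure_subalgebra_axioms.intro subalgebra_past finite_measure_axioms)

text \<open>
  A partial map \<open>\<phi>\<close> says which coordinate of \<open>Y n\<close> enters a product; outside its domain the factor is
  \<open>1\<close>. Every monomial is then a product over an initial segment \<open>{..<n}\<close>, whether or not each time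
  occurs in it, which allows induction on \<open>n\<close>.
\<close>
definition factor :: "(nat \<rightharpoonup> 'd) \<Rightarrow> nat \<Rightarrow> 'a \<Rightarrow> real" where
  "factor \<phi> n \<omega> = (case \<phi> n of None \<Rightarrow> 1 | Some i \<Rightarrow> Y n \<omega> $ i)"

lemma factor_past: "i < n \<Longrightarrow> factor \<phi> i \<in> borel_measurable (past M Y n)"
  unfolding factor_def
  by (cases "\<phi> i") (auto intro!: borel_measurable_nth measurable_past)

lemma factor_measurable [measurable]: "factor \<phi> n \<in> borel_measurable M"
  unfolding factor_def by (cases "\<phi> n") (auto intro!: borel_measurable_nth)

text \<open>
  With the value \<open>1\<close> for absent factors, the moment conditions say that at each time \<open>n\<close> the functions
  \<open>1, Y\<^sub>n\<^sup>1, \<dots>, Y\<^sub>n\<^sup>d\<close> are conditionally orthonormal.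
\<close>
lemma cond_exp_factor_mult:
  "AE \<omega> in M. real_cond_exp M (past M Y n) (\<lambda>\<omega>. factor \<phi> n \<omega> * factor \<psi> n \<omega>) \<omega>
     = of_bool (\<phi> n = \<psi> n)"
proof -
  interpret past: sigma_finite_subalgebra M "past M Y n"
    by (rule sigma_finite_subalgebra_past)
  have "AE \<omega> in M. real_cond_exp M (past M Y n) (\<lambda>\<omega>. 1) \<omega> = 1"
    by (rule past.real_cond_exp_F_meas) auto
  then show ?thesis
    using Y_cond_mean[of n] Y_cond_cov[of n "the (\<phi> n)" "the (\<psi> n)"]
    by (cases "\<phi> n"; cases "\<psi> n") (auto simp: factor_def split: if_splits)
qed

lemma prod_factor_past: "(\<lambda>\<omega>. \<Prod>k<n. factor \<phi> k \<omega>) \<in> borel_measurable (past M Y n)"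
  by (intro borel_measurable_prod factor_past) auto

text \<open>
  The averaging property of the real conditional expectation presupposes that the product is
  integrable. For squares of monomials that is still to be proved, so they are treated with the
  conditional expectation of nonnegative functions.
\<close>
lemma nn_cond_exp_factor_square:
  "AE \<omega> in M. nn_cond_exp M (past M Y n) (\<lambda>\<omega>. ennreal ((factor \<phi> n \<omega>)\<^sup>2)) \<omega> = 1"
proof -
  interpret past: sigma_finite_subalgebra M "past M Y n"
    by (rule sigma_finite_subalgebra_past)
  have "AE \<omega> in M. nn_cond_exp M (past M Y n) (\<lambda>\<omega>. 0) \<omega> = 0"
    by (rule AE_symmetric[OF past.nn_cond_exp_F_meas]) auto
  then show ?thesis
    using cond_exp_factor_mult[of n \<phi> \<phi>]
  proof eventually_elim
    case (elim \<omega>)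
    have "enn2real (nn_cond_exp M (past M Y n) (\<lambda>\<omega>. ennreal ((factor \<phi> n \<omega>)\<^sup>2)) \<omega>) = 1"
      using elim by (simp add: real_cond_exp_def ennreal_neg power2_eq_square)
    then show ?case
      by simp
  qed
qed

text \<open>
  Conditioning on the past of the last time removes the last squared factor, whose conditional mean
  is \<open>1\<close>. Second moments of \<open>Y\<close> suffice, because each time contributes a single factor.
\<close>
lemma integrable_prod_factor_square: "integrable M (\<lambda>\<omega>. (\<Prod>k<n. factor \<phi> k \<omega>)\<^sup>2)"
proof -
  have "(\<integral>\<^sup>+\<omega>. ennreal ((\<Prod>k<n. factor \<phi> k \<omega>)\<^sup>2) \<partial>M) = 1"
  proof (induction n)
    case 0
    then show ?case by (simp add: emeasure_space_1)
  next
    case (Suc n)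
    interpret past: sigma_finite_subalgebra M "past M Y n"
      by (rule sigma_finite_subalgebra_past)
    have "(\<integral>\<^sup>+\<omega>. ennreal ((\<Prod>k<Suc n. factor \<phi> k \<omega>)\<^sup>2) \<partial>M)
       = (\<integral>\<^sup>+\<omega>. ennreal ((\<Prod>k<n. factor \<phi> k \<omega>)\<^sup>2) * ennreal ((factor \<phi> n \<omega>)\<^sup>2) \<partial>M)"
      by (simp add: power_mult_distrib ennreal_mult)
    also have "\<dots> = (\<integral>\<^sup>+\<omega>. ennreal ((\<Prod>k<n. factor \<phi> k \<omega>)\<^sup>2)
        * nn_cond_exp M (past M Y n) (\<lambda>\<omega>. ennreal ((factor \<phi> n \<omega>)\<^sup>2)) \<omega> \<partial>M)"
      using prod_factor_past by (intro past.nn_cond_exp_intg[symmetric]) auto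
    also have "\<dots> = (\<integral>\<^sup>+\<omega>. ennreal ((\<Prod>k<n. factor \<phi> k \<omega>)\<^sup>2) \<partial>M)"
      using nn_cond_exp_factor_square[of n \<phi>] by (intro nn_integral_cong_AE) auto
    finally show ?case using Suc by simp
  qed
  then show ?thesis by (intro integrableI_bounded) auto
qed


text \<open>
  Conditioning on the past of the latest time \<open>n\<close> replaces the two factors at \<open>n\<close> by \<open>1\<close> or \<open>0\<close>
  according to whether \<open>\<phi>\<close> and \<open>\<psi>\<close> agree there; the remaining product is known before \<open>n\<close>.
\<close>
lemma expectation_prod_factor_mult:
  "expectation (\<lambda>\<omega>. (\<Prod>k<n. factor \<phi> k \<omega>) * (\<Prod>k<n. factor \<psi> k \<omega>)) = of_bool (\<forall>k<n. \<phi> k = \<psi> k)"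
proof (induction n)
  case 0
  then show ?case by (simp add: prob_space)
next
  case (Suc n)
  interpret past: sigma_finite_subalgebra M "past M Y n"
    by (rule sigma_finite_subalgebra_past)
  let ?P = "\<lambda>\<omega>. (\<Prod>k<n. factor \<phi> k \<omega>) * (\<Prod>k<n. factor \<psi> k \<omega>)"
  let ?Q = "\<lambda>\<omega>. factor \<phi> n \<omega> * factor \<psi> n \<omega>"
  have split: "(\<Prod>k<Suc n. factor \<phi> k \<omega>) * (\<Prod>k<Suc n. factor \<psi> k \<omega>) = ?P \<omega> * ?Q \<omega>" for \<omega>
    by simp
  have "integrable M (\<lambda>\<omega>. (\<Prod>k<Suc n. factor \<phi> k \<omega>) * (\<Prod>k<Suc n. factor \<psi> k \<omega>))"
    by (intro integrable_mult_L2 integrable_prod_factor_square) measurable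
  then have int: "integrable M (\<lambda>\<omega>. ?P \<omega> * ?Q \<omega>)"
    unfolding split .
  have "expectation (\<lambda>\<omega>. ?P \<omega> * ?Q \<omega>) = expectation (\<lambda>\<omega>. ?P \<omega> * real_cond_exp M (past M Y n) ?Q \<omega>)"
    by (intro past.real_cond_exp_intg(2)[symmetric] int borel_measurable_times prod_factor_past) measurable
  also have "\<dots> = expectation (\<lambda>\<omega>. ?P \<omega> * of_bool (\<phi> n = \<psi> n))"
    using cond_exp_factor_mult[of n \<phi> \<psi>]
    by (intro integral_cong_AE) (auto intro!: borel_measurable_times)
  also have "\<dots> = of_bool (\<forall>k<Suc n. \<phi> k = \<psi> k)"
    using Suc by (auto simp: less_Suc_eq)
  finally show ?case unfolding split .
qed

definition monomial :: "(nat \<rightharpoonup> 'd) \<Rightarrow> 'a \<Rightarrow> real" where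
  "monomial \<phi> \<omega> = (\<Prod>n\<in>dom \<phi>. Y n \<omega> $ the (\<phi> n))"

lemma monomial_eq_prod_factor:
  assumes "dom \<phi> \<subseteq> {..<n}"
  shows "monomial \<phi> \<omega> = (\<Prod>k<n. factor \<phi> k \<omega>)"
  unfolding monomial_def
  using assms by (intro prod.mono_neutral_cong_left) (auto simp: factor_def)

lemma monomial_measurable [measurable]: "monomial \<phi> \<in> borel_measurable M"
  unfolding monomial_def by (intro borel_measurable_prod borel_measurable_nth Y_measurable)

lemma integrable_monomial_square:
  assumes "finite (dom \<phi>)"
  shows "integrable M (\<lambda>\<omega>. (monomial \<phi> \<omega>)\<^sup>2)"
proof -
  obtain n where "dom \<phi> \<subseteq> {..<n}"
    using assms finite_nat_iff_bounded by blast
  then show ?thesis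
    by (simp add: monomial_eq_prod_factor integrable_prod_factor_square)
qed

lemma expectation_monomial_mult:
  assumes "finite (dom \<phi>)" "finite (dom \<psi>)"
  shows "expectation (\<lambda>\<omega>. monomial \<phi> \<omega> * monomial \<psi> \<omega>) = of_bool (\<phi> = \<psi>)"
proof -
  obtain n where n: "dom \<phi> \<union> dom \<psi> \<subseteq> {..<n}"
    using assms finite_nat_iff_bounded by (meson finite_UnI)
  then have "(\<forall>k<n. \<phi> k = \<psi> k) \<longleftrightarrow> \<phi> = \<psi>"
    by (metis (no_types, lifting) Un_iff domIff ext lessThan_iff subsetD)
  then show ?thesis
    using n by (simp add: monomial_eq_prod_factor[of _ n] expectation_prod_factor_mult)
qed

text \<open>
  A Bessel-type bound for families that may repeat a monomial up to \<open>N\<close> times: off-diagonal terms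
  survive only within a class of equal monomials, where \<open>2ab \<le> a\<^sup>2 + b\<^sup>2\<close>.
\<close>
lemma expectation_sum_monomials_square_le:
  assumes "finite B" "\<And>i. i \<in> B \<Longrightarrow> finite (dom (\<phi> i))"
    and card: "\<And>i. i \<in> B \<Longrightarrow> card {j \<in> B. \<phi> j = \<phi> i} \<le> N"
  shows "expectation (\<lambda>\<omega>. (\<Sum>i\<in>B. c i * monomial (\<phi> i) \<omega>)\<^sup>2) \<le> real N * (\<Sum>i\<in>B. (c i)\<^sup>2)"
proof -
  have int: "integrable M (\<lambda>\<omega>. monomial (\<phi> i) \<omega> * monomial (\<phi> j) \<omega>)" if "i \<in> B" "j \<in> B" for i j
    using that assms by (intro integrable_mult_L2 integrable_monomial_square) auto
  have "expectation (\<lambda>\<omega>. (\<Sum>i\<in>B. c i * monomial (\<phi> i) \<omega>)\<^sup>2)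
      = expectation (\<lambda>\<omega>. \<Sum>i\<in>B. \<Sum>j\<in>B. (c i * c j) * (monomial (\<phi> i) \<omega> * monomial (\<phi> j) \<omega>))"
    by (simp add: power2_eq_square sum_product mult_ac)
  also have "\<dots> = (\<Sum>i\<in>B. \<Sum>j\<in>B. (c i * c j) * of_bool (\<phi> i = \<phi> j))"
    using assms int by (simp add: expectation_monomial_mult Bochner_Integration.integral_sum)
  also have "\<dots> \<le> (\<Sum>i\<in>B. \<Sum>j\<in>B. ((c i)\<^sup>2 / 2 + (c j)\<^sup>2 / 2) * of_bool (\<phi> i = \<phi> j))"
  proof (intro sum_mono mult_right_mono)
    show "c i * c j \<le> (c i)\<^sup>2 / 2 + (c j)\<^sup>2 / 2" for i j
      using sum_squares_bound[of "c i" "c j"] by simp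
  qed simp
  also have "\<dots> = (\<Sum>i\<in>B. \<Sum>j\<in>B. (c i)\<^sup>2 / 2 * of_bool (\<phi> i = \<phi> j))
      + (\<Sum>i\<in>B. \<Sum>j\<in>B. (c j)\<^sup>2 / 2 * of_bool (\<phi> i = \<phi> j))"
    by (simp add: distrib_right sum.distrib)
  also have "(\<Sum>i\<in>B. \<Sum>j\<in>B. (c j)\<^sup>2 / 2 * of_bool (\<phi> i = \<phi> j))
      = (\<Sum>i\<in>B. \<Sum>j\<in>B. (c i)\<^sup>2 / 2 * of_bool (\<phi> i = \<phi> j))"
    by (subst sum.swap) (simp only: eq_commute)
  also have "(\<Sum>i\<in>B. \<Sum>j\<in>B. (c i)\<^sup>2 / 2 * of_bool (\<phi> i = \<phi> j))
      + (\<Sum>i\<in>B. \<Sum>j\<in>B. (c i)\<^sup>2 / 2 * of_bool (\<phi> i = \<phi> j))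
      = (\<Sum>i\<in>B. (c i)\<^sup>2 * (\<Sum>j\<in>B. of_bool (\<phi> i = \<phi> j)))"
    by (simp flip: sum.distrib sum_distrib_left)
  also have "\<dots> \<le> (\<Sum>i\<in>B. (c i)\<^sup>2 * real N)"
  proof (intro sum_mono mult_left_mono)
    fix i assume "i \<in> B"
    have "(\<Sum>j\<in>B. of_bool (\<phi> i = \<phi> j)) = real (card {j \<in> B. \<phi> j = \<phi> i})"
      using \<open>finite B\<close> by (simp add: of_bool_def sum.If_cases Int_def eq_commute)
    then show "(\<Sum>j\<in>B. of_bool (\<phi> i = \<phi> j)) \<le> real N"
      using card[OF \<open>i \<in> B\<close>] by simp
  qed simp
  finally show ?thesis by (simp add: sum_distrib_left mult.commute)
qed

text \<open>
  Since the times in \<open>ns\<close> are distinct, zipping them with the coordinates defines a partial map, which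
  forgets exactly the simultaneous reordering of the two lists.
\<close>
lemma prod_nth_eq_monomial:
  assumes "ns \<in> Delta r" "ks \<in> multi_indices r"
  shows "(\<Prod>l<r. Y (ns ! l) \<omega> $ (ks ! l)) = monomial (map_of (zip ns ks)) \<omega>"
proof -
  have len: "length ns = r" "length ks = r" "distinct ns"
    using assms by (auto simp: Delta_def multi_indices_def)
  have "monomial (map_of (zip ns ks)) \<omega> = (\<Prod>n\<in>set ns. Y n \<omega> $ the (map_of (zip ns ks) n))"
    using len by (simp add: monomial_def)
  also have "\<dots> = (\<Prod>l<r. Y (ns ! l) \<omega> $ the (map_of (zip ns ks) (ns ! l)))"
    using len by (intro prod.reindex_bij_betw[symmetric] bij_betw_nth) auto
  also have "\<dots> = (\<Prod>l<r. Y (ns ! l) \<omega> $ (ks ! l))"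
    using len by (intro prod.cong) (auto simp: map_of_zip_nth)
  finally show ?thesis by simp
qed

end

section \<open>Pairs of lists that give the same monomial\<close>

lemma card_dom_map_of_zip:
  assumes "ns \<in> Delta r" "ks \<in> multi_indices r"
  shows "card (dom (map_of (zip ns ks))) = r"
  using assms by (simp add: Delta_def multi_indices_def distinct_card)

lemma finite_multi_indices: "finite (multi_indices r :: 'd::finite list set)"
  using finite_lists_length_eq[of "UNIV :: 'd set" r] by (simp add: multi_indices_def)

text \<open>
  The ways of writing the monomial of \<open>\<phi>\<close> as a summand of the multiple integral of order \<open>r\<close>.
\<close>
definition presentations :: "nat \<Rightarrow> (nat \<rightharpoonup> 'd) \<Rightarrow> ('d list \<times> nat list) set" where
  "presentations r \<phi> = {(js, ms). js \<in> multi_indices r \<and> ms \<in> Delta r \<and> map_of (zip ms js) = \<phi>}"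

text \<open>
  Two association lists with distinct keys define the same map iff they have the same entries, that is,
  iff one is a rearrangement of the other.
\<close>
lemma presentations_eq_orbit:
  assumes ns: "ns \<in> Delta r" and ks: "ks \<in> multi_indices r"
  shows "presentations r (map_of (zip ns ks))
    = (\<lambda>\<sigma>. (permute_list \<sigma> ks, permute_list \<sigma> ns)) ` {\<sigma>. \<sigma> permutes {..<r}}"
    (is "?F = ?P")
proof (intro equalityI subsetI)
  have len: "length ns = r" "distinct ns" "length ks = r"
    using ns ks by (auto simp: Delta_def multi_indices_def)
  fix p assume "p \<in> ?F"
  then obtain js ms where p: "p = (js, ms)"
    and len': "length ms = r" "distinct ms" "length js = r"
    and eq: "map_of (zip ms js) = map_of (zip ns ks)"
    by (auto simp: presentations_def Delta_def multi_indices_def)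
  have "set (zip ms js) = set (zip ns ks)"
    using eq len len' by (subst (asm) map_of_inject_set) auto
  then have "mset (zip ms js) = mset (zip ns ks)"
    using len len' by (subst (asm) set_eq_iff_mset_eq_distinct) (auto intro: distinct_zipI1)
  then obtain \<sigma> where \<sigma>: "\<sigma> permutes {..<r}" "permute_list \<sigma> (zip ns ks) = zip ms js"
    by (rule mset_eq_permutation) (simp add: len)
  then have "zip (permute_list \<sigma> ns) (permute_list \<sigma> ks) = zip ms js"
    using len by (simp add: permute_list_zip[of \<sigma> "{..<r}"])
  then have "permute_list \<sigma> ns = ms" "permute_list \<sigma> ks = js"
    using len len' zip_eq_conv by (metis length_permute_list map_fst_zip map_snd_zip)+
  then show "p \<in> ?P" using \<sigma> p by auto
next
  have len: "length ns = r" "distinct ns" "length ks = r"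
    using ns ks by (auto simp: Delta_def multi_indices_def)
  fix p assume "p \<in> ?P"
  then obtain \<sigma> where p: "p = (permute_list \<sigma> ks, permute_list \<sigma> ns)" and \<sigma>: "\<sigma> permutes {..<r}"
    by auto
  have "set (zip (permute_list \<sigma> ns) (permute_list \<sigma> ks)) = set (zip ns ks)"
    using \<sigma> len by (simp flip: permute_list_zip[of \<sigma> "{..<r}"])
  then have "map_of (zip (permute_list \<sigma> ns) (permute_list \<sigma> ks)) = map_of (zip ns ks)"
    using \<sigma> len by (subst map_of_inject_set) auto
  then show "p \<in> ?F"
    using p \<sigma> len by (auto simp: presentations_def Delta_def multi_indices_def)
qed

lemma inj_on_permute_distinct:
  assumes "distinct ns" "length ns = r"
  shows "inj_on (\<lambda>\<sigma>. permute_list \<sigma> ns) {\<sigma>. \<sigma> permutes {..<r}}"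
proof (rule inj_onI, clarify)
  fix \<sigma> \<tau> assume st: "\<sigma> permutes {..<r}" "\<tau> permutes {..<r}"
    and eq: "permute_list \<sigma> ns = permute_list \<tau> ns"
  show "\<sigma> = \<tau>"
  proof
    fix i
    show "\<sigma> i = \<tau> i"
    proof (cases "i < r")
      case True
      then have "ns ! \<sigma> i = ns ! \<tau> i" "\<sigma> i < r" "\<tau> i < r"
        using st eq assms permute_list_nth[of \<sigma> ns i] permute_list_nth[of \<tau> ns i]
          permutes_in_image[of \<sigma> _ i] permutes_in_image[of \<tau> _ i] by auto
      then show ?thesis using assms nth_eq_iff_index_eq by blast
    next
      case False
      then show ?thesis using st by (simp add: permutes_not_in)
    qed
  qed
qed

text \<open>
  This is where the factor \<open>r!\<close> comes from: the permutations act freely since the times are distinct,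
  and a symmetric kernel is constant on the orbit.
\<close>
lemma sum_presentations:
  assumes g: "symmetric_kernel r g" and ns: "ns \<in> Delta r" and ks: "ks \<in> multi_indices r"
  shows "(\<Sum>(js, ms)\<in>presentations r (map_of (zip ns ks)). g js ms) = fact r * g ks ns"
proof -
  have inj: "inj_on (\<lambda>\<sigma>. (permute_list \<sigma> ks, permute_list \<sigma> ns)) {\<sigma>. \<sigma> permutes {..<r}}"
    using ns inj_on_permute_distinct[of ns r] unfolding inj_on_def Delta_def by auto
  have "(\<Sum>(js, ms)\<in>presentations r (map_of (zip ns ks)). g js ms)
      = (\<Sum>\<sigma>\<in>{\<sigma>. \<sigma> permutes {..<r}}. g (permute_list \<sigma> ks) (permute_list \<sigma> ns))"
    unfolding presentations_eq_orbit[OF ns ks] by (subst sum.reindex[OF inj]) (simp add: o_def)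
  also have "\<dots> = (\<Sum>\<sigma>\<in>{\<sigma>. \<sigma> permutes {..<r}}. g ks ns)"
    using g ns ks by (intro sum.cong) (auto simp: symmetric_kernel_def)
  also have "\<dots> = fact r * g ks ns"
    by (simp add: card_permutations[of "{..<r}" r])
  finally show ?thesis .
qed

lemma finite_presentations: "finite (presentations r \<phi>)"
proof (cases "presentations r \<phi> = {}")
  case False
  then obtain ks ns where k: "ks \<in> multi_indices r" "ns \<in> Delta r" "map_of (zip ns ks) = \<phi>"
    by (auto simp: presentations_def)
  then show ?thesis
    using presentations_eq_orbit[OF k(2,1)] finite_permutations[of "{..<r}"] by simp
qed simp

text \<open>
  With the coordinates \<open>ks\<close> held fixed, several tuples of times can still give the same monomial, namely
  when \<open>ks\<close> has repeated entries.
\<close>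
lemma card_same_map_of_zip_le:
  assumes "finite B" "B \<subseteq> Delta r" "ns \<in> B" "ks \<in> multi_indices r"
  shows "card {ms \<in> B. map_of (zip ms ks) = map_of (zip ns ks)} \<le> fact r"
proof -
  have "card {ms \<in> B. map_of (zip ms ks) = map_of (zip ns ks)}
      = card (Pair ks ` {ms \<in> B. map_of (zip ms ks) = map_of (zip ns ks)})"
    by (simp add: card_image inj_on_def)
  also have "\<dots> \<le> card (presentations r (map_of (zip ns ks)))"
    using assms by (intro card_mono finite_presentations) (auto simp: presentations_def)
  also have "\<dots> = card ((\<lambda>\<sigma>. (permute_list \<sigma> ks, permute_list \<sigma> ns)) ` {\<sigma>. \<sigma> permutes {..<r}})"
    using assms by (subst presentations_eq_orbit) auto
  also have "\<dots> \<le> fact r"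
    using card_image_le[OF finite_permutations[of "{..<r}"]] card_permutations[of "{..<r}" r]
    by (metis card_lessThan finite_lessThan)
  finally show ?thesis .
qed

section \<open>The isometry\<close>

context normal_noise
begin

definition component_integral :: "nat \<Rightarrow> ('d list \<Rightarrow> nat list \<Rightarrow> real) \<Rightarrow> 'd list \<Rightarrow> 'a \<Rightarrow> real" where
  "component_integral r f ks = L2_sum M (\<lambda>ns \<omega>. f ks ns * (\<Prod>l<r. Y (ns ! l) \<omega> $ (ks ! l))) (Delta r)"

lemma integrable_term_square:
  "integrable M (\<lambda>\<omega>. (c * monomial (map_of xs) \<omega>)\<^sup>2)"
  by (simp add: power_mult_distrib integrable_monomial_square finite_dom_map_of)

text \<open>
  Convergence of the series makes the choice in \<open>L2_sum\<close> a genuine sum. The terms for fixed \<open>ks\<close> are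
  orthogonal up to repetition at most \<open>r!\<close> times, so tails of the series are controlled by tails of
  \<open>\<Sum> (f ks ns)\<^sup>2\<close>.
\<close>
lemma has_L2_sum_component_integral:
  assumes f: "square_summable_kernel r f" and ks: "ks \<in> multi_indices r"
  shows "has_L2_sum M (\<lambda>ns \<omega>. f ks ns * monomial (map_of (zip ns ks)) \<omega>) (Delta r)
    (component_integral r f ks)"
proof -
  let ?h = "\<lambda>ns \<omega>. f ks ns * monomial (map_of (zip ns ks)) \<omega>"
  have exists: "\<exists>X. has_L2_sum M ?h (Delta r) X"
  proof (rule L2_Cauchy_has_L2_sum)
    fix \<epsilon> :: real assume "\<epsilon> > 0"
    then obtain A where A: "finite A" "A \<subseteq> Delta r"
      "\<And>B. finite B \<Longrightarrow> B \<subseteq> Delta r - A \<Longrightarrow> (\<Sum>ns\<in>B. (f ks ns)\<^sup>2) < \<epsilon> / fact r"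
      using f ks summable_on_tail_small[of "\<lambda>ns. (f ks ns)\<^sup>2" "Delta r" "\<epsilon> / fact r"]
      unfolding square_summable_kernel_def by auto
    have "expectation (\<lambda>\<omega>. (\<Sum>ns\<in>B. ?h ns \<omega>)\<^sup>2) < \<epsilon>" if B: "finite B" "B \<subseteq> Delta r - A" for B
    proof -
      have "expectation (\<lambda>\<omega>. (\<Sum>ns\<in>B. ?h ns \<omega>)\<^sup>2) \<le> real (fact r) * (\<Sum>ns\<in>B. (f ks ns)\<^sup>2)"
        using B ks
        by (intro expectation_sum_monomials_square_le card_same_map_of_zip_le) (auto simp: finite_dom_map_of)
      also have "\<dots> < fact r * (\<epsilon> / fact r)"
        using A(3)[OF B] by (simp add: field_simps)
      finally show ?thesis by simp
    qed
    with A show "\<exists>A. finite A \<and> A \<subseteq> Delta r \<and> (\<forall>B. finite B \<longrightarrow> B \<subseteq> Delta r - A \<longrightarrow>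
        expectation (\<lambda>\<omega>. (\<Sum>ns\<in>B. ?h ns \<omega>)\<^sup>2) < \<epsilon>)"
      by blast
  qed (auto intro!: integrable_term_square)
  have same: "has_L2_sum M (\<lambda>ns \<omega>. f ks ns * (\<Prod>l<r. Y (ns ! l) \<omega> $ (ks ! l))) (Delta r)
      = has_L2_sum M ?h (Delta r)"
    by (intro ext has_L2_sum_cong) (simp add: prod_nth_eq_monomial[OF _ ks])
  show ?thesis
    unfolding component_integral_def L2_sum_def same by (rule someI_ex[OF exists])
qed

lemma component_integral_L2:
  assumes "square_summable_kernel r f" "ks \<in> multi_indices r"
  shows "component_integral r f ks \<in> borel_measurable M"
    and "integrable M (\<lambda>\<omega>. (component_integral r f ks \<omega>)\<^sup>2)"
  using has_L2_sum_component_integral[OF assms] by (simp_all add: has_L2_sum_def)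

lemma multiple_integral_eq: "multiple_integral M Y r f = (\<lambda>\<omega>. \<Sum>ks\<in>multi_indices r. component_integral r f ks \<omega>)"
  by (simp add: multiple_integral_def component_integral_def fun_eq_iff)

lemma multiple_integral_L2:
  assumes "square_summable_kernel r f"
  shows "multiple_integral M Y r f \<in> borel_measurable M"
    and "integrable M (\<lambda>\<omega>. (multiple_integral M Y r f \<omega>)\<^sup>2)"
  unfolding multiple_integral_eq using component_integral_L2[OF assms]
  by (auto intro!: integrable_sum_square_L2 borel_measurable_sum)

lemma expectation_component_integral_mult_monomial:
  assumes f: "square_summable_kernel r f" and ks: "ks \<in> multi_indices r" and \<phi>: "finite (dom \<phi>)"
  shows "expectation (\<lambda>\<omega>. component_integral r f ks \<omega> * monomial \<phi> \<omega>)
    = (\<Sum>ns | ns \<in> Delta r \<and> map_of (zip ns ks) = \<phi>. f ks ns)"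
proof -
  let ?h = "\<lambda>ns \<omega>. f ks ns * monomial (map_of (zip ns ks)) \<omega>"
  let ?S = "{ns. ns \<in> Delta r \<and> map_of (zip ns ks) = \<phi>}"
  have "((\<lambda>ns. expectation (\<lambda>\<omega>. ?h ns \<omega> * monomial \<phi> \<omega>)) has_sum
      expectation (\<lambda>\<omega>. component_integral r f ks \<omega> * monomial \<phi> \<omega>)) (Delta r)"
    by (intro has_L2_sum_inner has_L2_sum_component_integral f ks integrable_term_square
        integrable_monomial_square \<phi>) auto
  also have "(\<lambda>ns. expectation (\<lambda>\<omega>. ?h ns \<omega> * monomial \<phi> \<omega>))
      = (\<lambda>ns. f ks ns * of_bool (map_of (zip ns ks) = \<phi>))"
    using \<phi> by (simp add: mult.assoc expectation_monomial_mult finite_dom_map_of)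
  finally have "((\<lambda>ns. f ks ns * of_bool (map_of (zip ns ks) = \<phi>)) has_sum
      expectation (\<lambda>\<omega>. component_integral r f ks \<omega> * monomial \<phi> \<omega>)) (Delta r)" .
  then have "(f ks has_sum expectation (\<lambda>\<omega>. component_integral r f ks \<omega> * monomial \<phi> \<omega>)) ?S"
    by (rule has_sum_cong_neutral[THEN iffD1, rotated -1]) auto
  moreover have "finite ?S"
  proof (rule finite_subset)
    show "?S \<subseteq> snd ` presentations r \<phi>"
      using ks by (force simp: presentations_def)
  qed (intro finite_imageI finite_presentations)
  then have "(f ks has_sum (\<Sum>ns\<in>?S. f ks ns)) ?S"
    by (rule has_sum_finite)
  ultimately show ?thesis by (rule has_sum_unique)
qed

text \<open>
  The Fourier coefficient of a multiple integral: pairing with a monomial picks out all presentations of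
  that monomial of the given length, and there are none of length \<open>s \<noteq> r\<close>.
\<close>
lemma expectation_multiple_integral_mult_monomial:
  assumes g: "square_summable_kernel s g" "symmetric_kernel s g"
    and ns: "ns \<in> Delta r" and ks: "ks \<in> multi_indices r"
  shows "expectation (\<lambda>\<omega>. monomial (map_of (zip ns ks)) \<omega> * multiple_integral M Y s g \<omega>)
    = (if s = r then fact r * g ks ns else 0)"
proof -
  let ?\<phi> = "map_of (zip ns ks)"
  have "expectation (\<lambda>\<omega>. monomial ?\<phi> \<omega> * multiple_integral M Y s g \<omega>)
      = expectation (\<lambda>\<omega>. \<Sum>js\<in>multi_indices s. component_integral s g js \<omega> * monomial ?\<phi> \<omega>)"
    by (simp add: multiple_integral_eq sum_distrib_left mult.commute)
  also have "\<dots> = (\<Sum>js\<in>multi_indices s. expectation (\<lambda>\<omega>. component_integral s g js \<omega> * monomial ?\<phi> \<omega>))"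
    using component_integral_L2[OF g(1)]
    by (intro Bochner_Integration.integral_sum integrable_mult_L2)
      (auto intro!: integrable_monomial_square simp: finite_dom_map_of)
  also have "\<dots> = (\<Sum>js\<in>multi_indices s. \<Sum>ms | ms \<in> Delta s \<and> map_of (zip ms js) = ?\<phi>. g js ms)"
    by (intro sum.cong refl expectation_component_integral_mult_monomial g) (auto simp: finite_dom_map_of)
  also have "\<dots> = (\<Sum>(js, ms)\<in>presentations s ?\<phi>. g js ms)"
  proof -
    have fin: "finite {ms \<in> Delta s. map_of (zip ms js) = ?\<phi>}" if "js \<in> multi_indices s" for js
    proof (rule finite_subset)
      show "{ms \<in> Delta s. map_of (zip ms js) = ?\<phi>}
        \<subseteq> snd ` presentations s ?\<phi>"
        using that by (force simp: presentations_def)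
    qed (intro finite_imageI finite_presentations)
    then show ?thesis
      by (subst sum.Sigma) (auto intro!: sum.cong simp: finite_multi_indices presentations_def)
  qed
  also have "\<dots> = (if s = r then fact r * g ks ns else 0)"
  proof (cases "s = r")
    case True
    then show ?thesis using sum_presentations[OF _ ns ks] g by simp
  next
    case False
    then have "presentations s ?\<phi> = {}"
      using card_dom_map_of_zip[OF ns ks] by (auto simp: presentations_def dest: card_dom_map_of_zip)
    then show ?thesis using False by simp
  qed
  finally show ?thesis .
qed

text \<open>
  Only one of the two integrals is expanded into monomials; the other one enters through its Fourier
  coefficients. This avoids a double series.
\<close>
lemma multiple_integral_isometry:
  assumes f: "square_summable_kernel r f"
    and g: "square_summable_kernel s g" "symmetric_kernel s g"
  shows "expectation (\<lambda>\<omega>. multiple_integral M Y r f \<omega> * multiple_integral M Y s g \<omega>)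
    = (if s = r then fact r * (\<Sum>ks\<in>multi_indices r. \<Sum>\<^sub>\<infinity>ns\<in>Delta r. f ks ns * g ks ns) else 0)"
proof -
  let ?G = "multiple_integral M Y s g"
  have G: "?G \<in> borel_measurable M" "integrable M (\<lambda>\<omega>. (?G \<omega>)\<^sup>2)"
    by (rule multiple_integral_L2[OF g(1)])+
  have part: "expectation (\<lambda>\<omega>. component_integral r f ks \<omega> * ?G \<omega>)
      = (\<Sum>\<^sub>\<infinity>ns\<in>Delta r. f ks ns * (if s = r then fact r * g ks ns else 0))"
    if ks: "ks \<in> multi_indices r" for ks
  proof -
    have "((\<lambda>ns. expectation (\<lambda>\<omega>. (f ks ns * monomial (map_of (zip ns ks)) \<omega>) * ?G \<omega>)) has_sum
        expectation (\<lambda>\<omega>. component_integral r f ks \<omega> * ?G \<omega>)) (Delta r)"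
      by (intro has_L2_sum_inner has_L2_sum_component_integral f ks integrable_term_square G) auto
    then have "expectation (\<lambda>\<omega>. component_integral r f ks \<omega> * ?G \<omega>)
      = (\<Sum>\<^sub>\<infinity>ns\<in>Delta r. expectation (\<lambda>\<omega>. (f ks ns * monomial (map_of (zip ns ks)) \<omega>) * ?G \<omega>))"
      by (rule infsumI[symmetric])
    also have "\<dots> = (\<Sum>\<^sub>\<infinity>ns\<in>Delta r. f ks ns * (if s = r then fact r * g ks ns else 0))"
      using expectation_multiple_integral_mult_monomial[OF g _ ks]
      by (intro infsum_cong) (simp add: mult.assoc)
    finally show ?thesis .
  qed
  have "expectation (\<lambda>\<omega>. multiple_integral M Y r f \<omega> * ?G \<omega>)
      = (\<Sum>ks\<in>multi_indices r. expectation (\<lambda>\<omega>. component_integral r f ks \<omega> * ?G \<omega>))"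
    unfolding multiple_integral_eq[of r f] sum_distrib_right
    using component_integral_L2[OF f] G
    by (intro Bochner_Integration.integral_sum integrable_mult_L2) auto
  also have "\<dots> = (\<Sum>ks\<in>multi_indices r. \<Sum>\<^sub>\<infinity>ns\<in>Delta r. f ks ns * (if s = r then fact r * g ks ns else 0))"
    by (intro sum.cong refl part)
  also have "\<dots> = (if s = r then fact r * (\<Sum>ks\<in>multi_indices r. \<Sum>\<^sub>\<infinity>ns\<in>Delta r. f ks ns * g ks ns) else 0)"
    by (simp add: mult.left_commute infsum_cmult_right' sum_distrib_left)
  finally show ?thesis .
qed

end

theorem proposition3p4:
  fixes M :: "'a measure"
    and Y :: "nat \<Rightarrow> 'a \<Rightarrow> real ^ 'd"
    and r s :: nat
    and f g :: "'d list \<Rightarrow> nat list \<Rightarrow> real"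
  assumes "prob_space M"
    and "\<And>n. Y n \<in> borel_measurable M"
    and "\<And>n i. integrable M (\<lambda>\<omega>. (Y n \<omega> $ i)\<^sup>2)"
    and "\<And>n i. AE \<omega> in M. real_cond_exp M (past M Y n) (\<lambda>\<omega>. Y n \<omega> $ i) \<omega> = 0"
    and "\<And>n i j. AE \<omega> in M. real_cond_exp M (past M Y n) (\<lambda>\<omega>. Y n \<omega> $ i * Y n \<omega> $ j) \<omega>
           = (if i = j then 1 else 0)"
    and "1 \<le> r" and "1 \<le> s"
    and "square_summable_kernel r f" and "symmetric_kernel r f"
    and "square_summable_kernel s g" and "symmetric_kernel s g"
  shows "integrable M (\<lambda>\<omega>. multiple_integral M Y r f \<omega> * multiple_integral M Y s g \<omega>) \<and>
    (\<integral>\<omega>. multiple_integral M Y r f \<omega> * multiple_integral M Y s g \<omega> \<partial>M) =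
      (if s = r
       then fact r * (\<Sum>ks\<in>multi_indices r. \<Sum>\<^sub>\<infinity>ns\<in>Delta r. f ks ns * g ks ns)
       else 0)"
proof -
  interpret normal_noise M Y
    using assms by (intro normal_noise.intro normal_noise_axioms.intro)
  show ?thesis
    using multiple_integral_L2[OF \<open>square_summable_kernel r f\<close>]
      multiple_integral_L2[OF \<open>square_summable_kernel s g\<close>]
      multiple_integral_isometry[OF \<open>square_summable_kernel r f\<close>
        \<open>square_summable_kernel s g\<close> \<open>symmetric_kernel s g\<close>]
    by (intro conjI integrable_mult_L2)
qed

end
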